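(* Let $A$ be a positive semidefinite (complex Hermitian) $d\times d$ matrix. Then its average Fischer products satisfy: (a) $\overline{S}_k(A)\le\overline{S}_\ell(A)$ for $0\le k\le\ell\le\left[\frac d2\right]$; (b) $\overline{S}_k(A)^2\ge\overline{S}_{k-1}(A)\,\overline{S}_{k+1}(A)$ for $1\le k\le d-1$; (c) if $A$ is positive definite, then $$\frac{\overline{S}_1(A)}{\det(A)}\ \ge\ \sqrt{\frac{\overline{S}_2(A)}{\det(A)}}\ \ge\ \sqrt[3]{\frac{\overline{S}_3(A)}{\det(A)}}\ \ge\ \cdots\ \ge\ \sqrt[d]{\frac{\overline{S}_d(A)}{\det(A)}}=1.$$
   Context: $A[\mathcal{S}]$ denotes the principal submatrix of $A$ with rows and columns indexed by $\mathcal{S}\subseteq\{1,\ldots,d\}$, $\mathcal{S}'$ is the complement of $\mathcal{S}$ in $\{1,\ldots,d\}$, and $\det(A[\emptyset])=1$. For a matrix $A$ of order $d$ and $0\le k\le d$, the $k$-th symmetrized Fischer product is $$S_k(A)=\sum_{|\mathcal{S}|=k}\det(A[\mathcal{S}])\det(A[\mathcal{S}']),$$ the sum being over all $\mathcal{S}\subseteq\{1,\ldots,d\}$ with $|\mathcal{S}|=k$, and the $k$-th average Fischer product is $\overline{S}_k(A)=\binom dk^{-1}S_k(A)$. $[x]$ denotes the integer part of $x$. *)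

theory Defs
  imports Complex_Main
    "Jordan_Normal_Form.Determinant"
    "Jordan_Normal_Form.Schur_Decomposition"
    "Jordan_Normal_Form.DL_Submatrix"
begin

text \<open>Matrix indices run over 0, ..., d - 1 instead of 1, ..., d. The order on the complex numbers
  is that of \<^theory>\<open>HOL-Library.Complex_Order\<close>: \<open>x \<le> y\<close> means that \<open>y - x\<close> is a
  nonnegative real; in particular \<open>0 \<le> z\<close> includes that \<open>z\<close> is real.\<close>

definition hermitian_mat :: "complex mat \<Rightarrow> bool" where
  "hermitian_mat A \<longleftrightarrow> square_mat A \<and> mat_adjoint A = A"

text \<open>\<open>(A *\<^sub>v v) \<bullet>c v\<close> is the Hermitian form \<open>v* A v\<close>, as \<open>\<bullet>c\<close> conjugates its second
  argument.\<close>

definition pos_semidef_mat :: "complex mat \<Rightarrow> bool" where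
  "pos_semidef_mat A \<longleftrightarrow>
     hermitian_mat A \<and> (\<forall>v \<in> carrier_vec (dim_row A). 0 \<le> (A *\<^sub>v v) \<bullet>c v)"

definition pos_def_mat :: "complex mat \<Rightarrow> bool" where
  "pos_def_mat A \<longleftrightarrow>
     hermitian_mat A \<and>
     (\<forall>v \<in> carrier_vec (dim_row A). v \<noteq> 0\<^sub>v (dim_row A) \<longrightarrow> 0 < (A *\<^sub>v v) \<bullet>c v)"

text \<open>For empty \<open>S\<close> the matrix \<open>submatrix A S S\<close> is the 0 by 0 matrix, whose library determinant
  is 1.\<close>

definition fischer_sum :: "nat \<Rightarrow> complex mat \<Rightarrow> complex" where
  "fischer_sum k A =
     (\<Sum>S | S \<subseteq> {0..<dim_row A} \<and> card S = k.
        det (submatrix A S S) *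
        det (submatrix A ({0..<dim_row A} - S) ({0..<dim_row A} - S)))"

definition fischer_avg :: "nat \<Rightarrow> complex mat \<Rightarrow> complex" where
  "fischer_avg k A = fischer_sum k A / of_nat (dim_row A choose k)"

end

theory Submission
  imports Defs
begin

text \<open>For positive definite \<open>A\<close> the polynomial \<open>P(t) = \<Sum>k. S\<^sub>k t\<^sup>k\<close> has only negative real roots.
  Indeed, if the matrices \<open>M\<close> and \<open>N\<close> have positive definite imaginary parts, then
  \<open>\<Sum>S. det M[S] det N[S']\<close> does not vanish, and a root \<open>t\<close> of \<open>P\<close> that is not negative real gives
  such matrices \<open>u A\<close> and \<open>u t A\<close> with vanishing sum. The root factorization turns the \<open>S\<^sub>k\<close> into
  \<open>det A\<close> times elementary symmetric polynomials of positive numbers, so that (b) is Newton's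
  inequality and (c) is Maclaurin's; (a) follows from (b) and the symmetry
  \<open>S\<^sub>k = S\<^bsub>d-k\<^esub>\<close>. The semidefinite case is a limit of \<open>A + e I\<close> as \<open>e\<close> tends to 0.\<close>

section \<open>Principal minors, diagonal perturbations and dissipative matrices\<close>

text \<open>The Leibniz formula is taken over the permutations of \<open>K\<close> itself. Indices
  keep their names, so deleting an index or changing a diagonal entry requires no renumbering,
  unlike with \<open>submatrix\<close>.\<close>

definition principal_minor :: "(nat \<Rightarrow> nat \<Rightarrow> complex) \<Rightarrow> nat set \<Rightarrow> complex" where
  "principal_minor M K = (\<Sum>p | p permutes K. of_int (sign p) * (\<Prod>i\<in>K. M i (p i)))"

definition add_entry :: "(nat \<Rightarrow> nat \<Rightarrow> complex) \<Rightarrow> nat \<Rightarrow> complex \<Rightarrow> nat \<Rightarrow> nat \<Rightarrow> complex" where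
  "add_entry M k s = (\<lambda>i j. if i = k \<and> j = k then M i j + s else M i j)"

text \<open>The determinant is affine in a diagonal entry: only permutations fixing \<open>k\<close>
  see the change, and these are the permutations of \<open>K - {k}\<close>, with the same
  sign.\<close>

lemma principal_minor_add_entry:
  assumes "finite K" "k \<in> K"
  shows "principal_minor (add_entry M k s) K = principal_minor M K + s * principal_minor M (K - {k})"
proof -
  \<comment> \<open>The Leibniz term of \<open>K - {k}\<close>, extended by zero so that both sums
    run over the permutations of \<open>K\<close>.\<close>
  let ?g = "\<lambda>p. if p permutes (K - {k}) then of_int (sign p) * (\<Prod>i\<in>K - {k}. M i (p i)) else 0"
  have fin: "finite {p. p permutes K}"
    using assms by (simp add: finite_permutations)
  have "of_int (sign p) * (\<Prod>i\<in>K. add_entry M k s i (p i)) =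
        of_int (sign p) * (\<Prod>i\<in>K. M i (p i)) + s * ?g p" if p: "p permutes K" for p
  proof -
    have 1: "(\<Prod>i\<in>K - {k}. add_entry M k s i (p i)) = (\<Prod>i\<in>K - {k}. M i (p i))"
      by (intro prod.cong) (auto simp: add_entry_def)
    have 2: "p permutes (K - {k}) \<longleftrightarrow> p k = k"
      using permutes_superset[OF p, of "K - {k}"] permutes_not_in[of p "K - {k}" k] by auto
    have "(\<Prod>i\<in>K. add_entry M k s i (p i)) = add_entry M k s k (p k) * (\<Prod>i\<in>K - {k}. M i (p i))"
      using assms by (simp add: prod.remove 1)
    moreover have "(\<Prod>i\<in>K. M i (p i)) = M k (p k) * (\<Prod>i\<in>K - {k}. M i (p i))"
      using assms by (simp add: prod.remove)
    ultimately show ?thesis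
      unfolding 2 by (auto simp: add_entry_def algebra_simps)
  qed
  then have "principal_minor (add_entry M k s) K =
      principal_minor M K + s * (\<Sum>p | p permutes K. ?g p)"
    by (simp add: principal_minor_def sum.distrib sum_distrib_left)
  also have "(\<Sum>p | p permutes K. ?g p) = principal_minor M (K - {k})"
    unfolding principal_minor_def
    by (rule sum.mono_neutral_cong_right[OF fin]) (auto intro: permutes_subset)
  finally show ?thesis .
qed

lemma principal_minor_add_entry_notin:
  "k \<notin> K \<Longrightarrow> principal_minor (add_entry M k s) K = principal_minor M K"
  unfolding principal_minor_def
  by (intro sum.cong refl arg_cong2[where f = "(*)"] prod.cong) (auto simp: add_entry_def)

definition quad_form :: "nat \<Rightarrow> (nat \<Rightarrow> nat \<Rightarrow> complex) \<Rightarrow> (nat \<Rightarrow> complex) \<Rightarrow> complex" where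
  "quad_form d M v = (\<Sum>i<d. \<Sum>j<d. M i j * v j * cnj (v i))"

text \<open>Writing M minus its adjoint as 2 i H with H Hermitian, the imaginary part of the form of
  M is the form of H; so the imaginary part H is positive definite.\<close>

definition dissipative :: "nat \<Rightarrow> (nat \<Rightarrow> nat \<Rightarrow> complex) \<Rightarrow> bool" where
  "dissipative d M \<longleftrightarrow> (\<forall>v. (\<exists>i<d. v i \<noteq> 0) \<longrightarrow> 0 < Im (quad_form d M v))"

lemma quad_form_add_entry:
  assumes "k < d"
  shows "quad_form d (add_entry M k s) v = quad_form d M v + s * (cmod (v k))\<^sup>2"
proof -
  have "add_entry M k s i j * v j * cnj (v i) =
      M i j * v j * cnj (v i) + (if j = k then if i = k then s * v k * cnj (v k) else 0 else 0)"
    for i j by (auto simp: add_entry_def algebra_simps)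
  then have "quad_form d (add_entry M k s) v = quad_form d M v + s * v k * cnj (v k)"
    using assms by (simp add: quad_form_def sum.distrib)
  then show ?thesis
    by (simp add: mult.assoc complex_norm_square flip: of_real_power)
qed

lemma dissipative_add_entry:
  "dissipative d M \<Longrightarrow> k < d \<Longrightarrow> 0 \<le> Im s \<Longrightarrow> dissipative d (add_entry M k s)"
  unfolding dissipative_def
  by (auto simp: quad_form_add_entry simp flip: of_real_power intro!: add_pos_nonneg)

text \<open>Padding with identity rows and columns gives a matrix of fixed order \<open>d\<close>,
  to which the kernel criterion for a zero determinant applies.\<close>

lemma principal_minor_eq_det_padded:
  assumes "K \<subseteq> {..<d}"
  shows "principal_minor M K =
    det (mat d d (\<lambda>(i, j). if i \<in> K \<and> j \<in> K then M i j else if i = j then 1 else 0))"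
    (is "_ = det ?B")
proof -
  have "det ?B = (\<Sum>p | p permutes {0..<d}. signof p * (\<Prod>i = 0..<d. ?B $$ (i, p i)))"
    by (rule det_def') auto
  also have "\<dots> = (\<Sum>p | p permutes K. signof p * (\<Prod>i\<in>K. M i (p i)))"
  proof (rule sum.mono_neutral_cong_right)
    show "{p. p permutes K} \<subseteq> {p. p permutes {0..<d}}"
      using assms by (auto intro!: permutes_subset[of _ K] simp: subset_eq)
    show "\<forall>p\<in>{p. p permutes {0..<d}} - {p. p permutes K}.
        signof p * (\<Prod>i = 0..<d. ?B $$ (i, p i)) = 0"
    proof
      fix p assume p: "p \<in> {p. p permutes {0..<d}} - {p. p permutes K}"
      \<comment> \<open>A permutation that does not permute \<open>K\<close> moves some index
        outside \<open>K\<close>, and there the padded row has only zeros off the diagonal.\<close>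
      then obtain i where i: "i \<in> {0..<d} - K" "p i \<noteq> i"
        using permutes_superset[of p "{0..<d}" K] by auto
      then have "p i < d"
        using p i permutes_in_image[of p "{0..<d}" i] by auto
      then have "?B $$ (i, p i) = 0"
        using i by auto
      then have "(\<Prod>i = 0..<d. ?B $$ (i, p i)) = 0"
        using i by (intro prod_zero) auto
      then show "signof p * (\<Prod>i = 0..<d. ?B $$ (i, p i)) = 0"
        by simp
    qed
    fix p assume "p \<in> {p. p permutes K}"
    then have p: "p permutes K" by simp
    have "(\<Prod>i = 0..<d. ?B $$ (i, p i)) = (\<Prod>i\<in>K. M i (p i))"
    proof (rule prod.mono_neutral_cong_right)
      show "\<forall>i\<in>{0..<d} - K. ?B $$ (i, p i) = 1"
        using p by (auto simp: permutes_not_in)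
      show "?B $$ (i, p i) = M i (p i)" if "i \<in> K" for i
      proof -
        have "p i \<in> K" "i < d" "p i < d"
          using that assms permutes_in_image[OF p, of i] by auto
        then show ?thesis
          using that by simp
      qed
    qed (use assms in auto)
    then show "signof p * (\<Prod>i = 0..<d. ?B $$ (i, p i)) = signof p * (\<Prod>i\<in>K. M i (p i))"
      by simp
  qed (simp add: finite_permutations)
  finally show ?thesis
    by (simp add: principal_minor_def)
qed

text \<open>If the minor vanished, the padded matrix would have a kernel vector. It is supported in
  \<open>K\<close>, so the quadratic form of \<open>M\<close> would vanish at it, against
  dissipativity.\<close>

lemma principal_minor_nonzero:
  assumes M: "dissipative d M" and K: "K \<subseteq> {..<d}"
  shows "principal_minor M K \<noteq> 0"
proof
  define B where "B = mat d d (\<lambda>(i, j). if i \<in> K \<and> j \<in> K then M i j else if i = j then 1 else 0)"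
  have B: "B \<in> carrier_mat d d"
    by (simp add: B_def)
  assume "principal_minor M K = 0"
  then have "det B = 0"
    using principal_minor_eq_det_padded[OF K] by (simp add: B_def)
  then obtain v where v: "v \<in> carrier_vec d" "v \<noteq> 0\<^sub>v d" "B *\<^sub>v v = 0\<^sub>v d"
    using det_0_iff_vec_prod_zero[OF B] by blast
  have row: "(\<Sum>j<d. B $$ (i, j) * v $ j) = 0" if "i < d" for i
  proof -
    have "(B *\<^sub>v v) $ i = 0"
      using v(3) that by simp
    then show ?thesis
      using v(1) B that by (simp add: scalar_prod_def atLeast0LessThan)
  qed
  \<comment> \<open>Row \<open>i\<close> of \<open>B\<close> is a row of the identity.\<close>
  have out: "v $ i = 0" if "i < d" "i \<notin> K" for i
  proof -
    have "(\<Sum>j<d. B $$ (i, j) * v $ j) = (\<Sum>j<d. if j = i then v $ i else 0)"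
      using that by (intro sum.cong) (auto simp: B_def)
    then show ?thesis
      using row[OF that(1)] that by simp
  qed
  have "quad_form d M (($) v) = 0"
    unfolding quad_form_def
  proof (rule sum.neutral, rule ballI)
    fix i assume "i \<in> {..<d}"
    then have i: "i < d" by simp
    show "(\<Sum>j<d. M i j * v $ j * cnj (v $ i)) = 0"
    proof (cases "i \<in> K")
      case True
      \<comment> \<open>For \<open>j\<close> outside \<open>K\<close> both terms are zero: on the
        left because \<open>v $ j = 0\<close>, on the right because of the padding.\<close>
      have "(\<Sum>j<d. M i j * v $ j) = (\<Sum>j<d. B $$ (i, j) * v $ j)"
        using True i out by (intro sum.cong) (auto simp: B_def)
      then show ?thesis
        using row[OF i] by (simp flip: sum_distrib_right)
    qed (use out i in simp)
  qed
  moreover have "\<exists>i<d. v $ i \<noteq> 0"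
  proof (rule ccontr)
    assume "\<not> (\<exists>i<d. v $ i \<noteq> 0)"
    then have "v = 0\<^sub>v d"
      using v(1) by (intro eq_vecI) auto
    with v(2) show False ..
  qed
  ultimately show False
    using M unfolding dissipative_def by fastforce
qed

section \<open>Convolutions of principal minors do not vanish\<close>

text \<open>Without a linear term the quadratic is even in \<open>s\<close>, so its roots are
  opposite and one of them has nonnegative imaginary part.\<close>

lemma linear_coeff_nonzero:
  fixes a b c :: complex
  assumes "c \<noteq> 0" and nz: "\<And>s. 0 \<le> Im s \<Longrightarrow> a + b * s + c * s\<^sup>2 \<noteq> 0"
  shows "b \<noteq> 0"
proof
  assume "b = 0"
  define r where "r = csqrt (- a / c)"
  have r: "a + c * r\<^sup>2 = 0"
    using \<open>c \<noteq> 0\<close> by (simp add: r_def)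
  show False
    using nz[of r] nz[of "- r"] r \<open>b = 0\<close> by (cases "0 \<le> Im r") auto
qed

text \<open>Interpolates between the product of the two minors on \<open>K\<close>, at
  \<open>U = {}\<close>, and the full convolution, at \<open>U = K\<close>: for
  \<open>U \<subseteq> K\<close> the indices in \<open>K - U\<close> stay in both minors, those in
  \<open>U\<close> in exactly one.\<close>

definition minor_convolution ::
  "(nat \<Rightarrow> nat \<Rightarrow> complex) \<Rightarrow> (nat \<Rightarrow> nat \<Rightarrow> complex) \<Rightarrow> nat set \<Rightarrow> nat set \<Rightarrow> complex" where
  "minor_convolution M N U K =
     (\<Sum>S\<in>Pow U. principal_minor M (K - S) * principal_minor N (K - (U - S)))"

text \<open>Split by whether the subset contains \<open>k\<close>: if not, \<open>k\<close> is
  deleted from the second minor, otherwise from the first.\<close>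

lemma minor_convolution_insert:
  assumes "finite U" "k \<notin> U"
  shows "minor_convolution M N (insert k U) K =
    (\<Sum>S\<in>Pow U. principal_minor M (K - S) * principal_minor N (K - {k} - (U - S)) +
                principal_minor M (K - {k} - S) * principal_minor N (K - (U - S)))"
proof -
  let ?t = "\<lambda>S. principal_minor M (K - S) * principal_minor N (K - (insert k U - S))"
  have "minor_convolution M N (insert k U) K = sum ?t (Pow U) + sum ?t (insert k ` Pow U)"
    unfolding minor_convolution_def Pow_insert
    using assms by (intro sum.union_disjoint) auto
  also have "sum ?t (insert k ` Pow U) = (\<Sum>S\<in>Pow U. ?t (insert k S))"
    using assms by (subst sum.reindex) (auto simp: inj_on_def)
  also have "sum ?t (Pow U) =
      (\<Sum>S\<in>Pow U. principal_minor M (K - S) * principal_minor N (K - {k} - (U - S)))"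
  proof (rule sum.cong)
    fix S assume "S \<in> Pow U"
    then have "K - (insert k U - S) = K - {k} - (U - S)"
      using assms by auto
    then show "?t S = principal_minor M (K - S) * principal_minor N (K - {k} - (U - S))"
      by simp
  qed simp
  also have "(\<Sum>S\<in>Pow U. ?t (insert k S)) =
      (\<Sum>S\<in>Pow U. principal_minor M (K - {k} - S) * principal_minor N (K - (U - S)))"
  proof (rule sum.cong)
    fix S assume "S \<in> Pow U"
    then have "K - (insert k U - insert k S) = K - (U - S)" "K - insert k S = K - {k} - S"
      using assms by auto
    then show "?t (insert k S) =
        principal_minor M (K - {k} - S) * principal_minor N (K - (U - S))"
      by simp
  qed simp
  finally show ?thesis
    by (simp add: sum.distrib)
qed

text \<open>As \<open>k\<close> lies outside \<open>U\<close>, it belongs to both minors of every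
  term, and each is affine in \<open>s\<close>. The linear coefficient deletes \<open>k\<close> from
  exactly one of them, which is the sum for \<open>insert k U\<close>; the quadratic one deletes it
  from both.\<close>

lemma minor_convolution_add_entry:
  assumes "finite K" "U \<subseteq> K" "k \<in> K" "k \<notin> U"
  shows "minor_convolution (add_entry M k s) (add_entry N k s) U K =
    minor_convolution M N U K + minor_convolution M N (insert k U) K * s +
    minor_convolution M N U (K - {k}) * s\<^sup>2"
proof -
  have fU: "finite U"
    using assms(1,2) by (rule rev_finite_subset)
  have *: "principal_minor (add_entry M k s) (K - S) =
      principal_minor M (K - S) + s * principal_minor M (K - {k} - S)"
    if "S \<subseteq> U" for M S
  proof -
    have "K - S - {k} = K - {k} - S" by auto
    then show ?thesis
      using principal_minor_add_entry[of "K - S" k M s] assms that by auto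
  qed
  have expand: "(a + s * a') * (b + s * b') = a * b + (a * b' + a' * b) * s + a' * b' * s\<^sup>2"
    for a a' b b' :: complex
    by (simp add: algebra_simps power2_eq_square)
  show ?thesis
    unfolding minor_convolution_insert[OF fU \<open>k \<notin> U\<close>] unfolding minor_convolution_def
    unfolding sum_distrib_right sum.distrib[symmetric]
  proof (rule sum.cong)
    fix S assume "S \<in> Pow U"
    then have S: "S \<subseteq> U" "U - S \<subseteq> U" by auto
    show "principal_minor (add_entry M k s) (K - S) *
          principal_minor (add_entry N k s) (K - (U - S)) =
        principal_minor M (K - S) * principal_minor N (K - (U - S)) +
        (principal_minor M (K - S) * principal_minor N (K - {k} - (U - S)) +
         principal_minor M (K - {k} - S) * principal_minor N (K - (U - S))) * s +
        principal_minor M (K - {k} - S) * principal_minor N (K - {k} - (U - S)) * s\<^sup>2"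
      unfolding *[OF S(1)] *[OF S(2)] by (rule expand)
  qed simp
qed

text \<open>The induction contracts one index at a time: adding \<open>s\<close> to the entry \<open>(k, k)\<close> of both matrices
  gives a quadratic polynomial in \<open>s\<close> without zeros in the closed upper half plane, whose linear
  coefficient is the next convolution.\<close>

lemma minor_convolution_nonzero:
  assumes "dissipative d M" "dissipative d N" "U \<subseteq> K" "K \<subseteq> {..<d}"
  shows "minor_convolution M N U K \<noteq> 0"
proof -
  have "finite U"
    using assms(3,4) by (meson finite_lessThan finite_subset)
  then show ?thesis using assms
  \<comment> \<open>\<open>K\<close>, \<open>M\<close> and \<open>N\<close> vary because the
    hypothesis is used on \<open>K - {k}\<close> for the leading coefficient and on the perturbed
    matrices for the whole quadratic.\<close>
  proof (induction U arbitrary: K M N rule: finite_induct)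
    case empty
    then show ?case by (simp add: minor_convolution_def principal_minor_nonzero)
  next
    case (insert k U)
    have K: "finite K" "U \<subseteq> K" "k \<in> K" "k < d"
      using insert.prems by (auto intro: finite_subset)
    show ?case
    proof (rule linear_coeff_nonzero)
      show "minor_convolution M N U (K - {k}) \<noteq> 0"
        using insert.prems insert.hyps by (intro insert.IH) auto
      fix s :: complex assume "0 \<le> Im s"
      then have "minor_convolution (add_entry M k s) (add_entry N k s) U K \<noteq> 0"
        using insert.prems K by (intro insert.IH dissipative_add_entry) auto
      then show "minor_convolution M N U K + minor_convolution M N (insert k U) K * s +
          minor_convolution M N U (K - {k}) * s\<^sup>2 \<noteq> 0"
        using minor_convolution_add_entry K insert.hyps by metis
    qed
  qed
qed

section \<open>Newton's inequality for elementary symmetric means\<close>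

text \<open>Here \<open>a\<close>, \<open>b\<close>, \<open>c\<close>, \<open>e\<close> stand for
  the consecutive means of indices k - 2 to k + 1 of a list of length m + k; the three linear
  combinations are, up to a common factor, means of the list extended by \<open>x\<close>. The
  factors \<open>m\<close> and \<open>k - 1\<close> make the hypotheses trivial where
  \<open>e\<close> or \<open>a\<close> falls out of range.\<close>

lemma newton_step:
  fixes a b c e m k x :: real
  assumes "0 \<le> m" "1 \<le> k" "0 \<le> x"
    and be: "m * (b * e) \<le> m * c\<^sup>2"
    and ac: "(k - 1) * (a * c) \<le> (k - 1) * b\<^sup>2"
    and ae: "m * (k - 1) * (a * e) \<le> m * (k - 1) * (b * c)"
  shows "(x * (m + 2) * b + (k - 1) * a) * (x * m * e + (k + 1) * c)
           \<le> (x * (m + 1) * c + k * b)\<^sup>2"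
proof -
  \<comment> \<open>The difference is a square plus nonnegative multiples of the slacks in
    \<open>be\<close>, \<open>ae\<close> and \<open>ac\<close>.\<close>
  have "(x * (m + 1) * c + k * b)\<^sup>2 -
      (x * (m + 2) * b + (k - 1) * a) * (x * m * e + (k + 1) * c) =
      (x * c - b)\<^sup>2 + x\<^sup>2 * (m + 2) * (m * c\<^sup>2 - m * (b * e)) +
      x * (m * (k - 1) * (b * c) - m * (k - 1) * (a * e)) +
      (k + 1) * ((k - 1) * b\<^sup>2 - (k - 1) * (a * c))"
    by (simp add: algebra_simps power2_eq_square)
  also have "\<dots> \<ge> 0"
    using assms by (intro add_nonneg_nonneg mult_nonneg_nonneg) auto
  finally show ?thesis by simp
qed

text \<open>With n the length, the coefficient of T^k in the product of the factors T + x is the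
  elementary symmetric polynomial of degree n - k. The indexing is thus reversed: index 0 gives the
  product of the entries, index n gives 1.\<close>

definition elem_mean :: "real list \<Rightarrow> nat \<Rightarrow> real" where
  "elem_mean xs k = coeff (\<Prod>x\<leftarrow>xs. [:x, 1:]) k / (length xs choose k)"

lemma degree_prod_linear: "degree (\<Prod>x\<leftarrow>xs. [:x, 1:] :: 'a::idom poly) = length xs"
proof (induction xs)
  case (Cons x xs)
  have "(\<Prod>x\<leftarrow>xs. [:x, 1:]) \<noteq> 0"
    by (auto simp: prod_list_zero_iff)
  then have "degree ([:x, 1:] * (\<Prod>x\<leftarrow>xs. [:x, 1:])) = Suc (length xs)"
    by (subst degree_mult_eq) (simp_all del: mult_pCons_left add: Cons.IH)
  then show ?case by simp
qed simp

lemma coeff_eq_elem_mean: "coeff (\<Prod>x\<leftarrow>xs. [:x, 1:]) k = elem_mean xs k * (length xs choose k)"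
proof (cases "k \<le> length xs")
  case True
  then have "(length xs choose k) \<noteq> 0"
    by (simp add: binomial_eq_0_iff)
  then show ?thesis
    by (simp add: elem_mean_def)
next
  case False
  then show ?thesis
    by (simp add: coeff_eq_0 degree_prod_linear)
qed

lemma elem_mean_Cons_0: "elem_mean (x # xs) 0 = x * elem_mean xs 0"
  by (simp add: elem_mean_def)

text \<open>Multiplication of the polynomial by T + x, with the binomial normalization carried
  along. At \<open>k = length xs\<close> the out-of-range mean has the factor zero.\<close>

lemma elem_mean_Cons_Suc:
  assumes "k \<le> length xs"
  shows "elem_mean (x # xs) (Suc k) * (length xs + 1) =
    x * (real (length xs) - real k) * elem_mean xs (Suc k) + (real k + 1) * elem_mean xs k"
proof -
  define n where "n = length xs"
  have k: "k \<le> n" using assms by (simp add: n_def)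
  have nz: "real (Suc n choose Suc k) \<noteq> 0"
    using k by (simp add: binomial_eq_0_iff del: binomial_Suc_Suc)
  \<comment> \<open>Facts 1 and 2 express both binomials of row \<open>n\<close> through
    \<open>Suc n choose Suc k\<close>, which cancels at the end.\<close>
  have "real (Suc k * (Suc n choose Suc k)) = real (Suc n * (n choose k))"
    using Suc_times_binomial_eq[of n k] by (simp add: mult.commute del: binomial_Suc_Suc)
  then have 1: "(real k + 1) * (Suc n choose Suc k) = (real n + 1) * (n choose k)"
    by (simp del: binomial_Suc_Suc add: algebra_simps)
  have 2: "(real n - real k) * (Suc n choose Suc k) = (real n + 1) * (n choose Suc k)"
  proof -
    have "real (Suc n choose Suc k) = (n choose k) + (n choose Suc k)"
      by simp
    then show ?thesis
      using 1 by (simp del: binomial_Suc_Suc add: algebra_simps)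
  qed
  have "elem_mean (x # xs) (Suc k) * (Suc n choose Suc k) =
      x * (elem_mean xs (Suc k) * (n choose Suc k)) + elem_mean xs k * (n choose k)"
    using coeff_eq_elem_mean[of "x # xs" "Suc k"] coeff_eq_elem_mean[of xs k]
      coeff_eq_elem_mean[of xs "Suc k"]
    by (simp del: binomial_Suc_Suc add: n_def)
  then have "elem_mean (x # xs) (Suc k) * (real n + 1) * (Suc n choose Suc k) =
      x * elem_mean xs (Suc k) * ((real n + 1) * (n choose Suc k)) +
      elem_mean xs k * ((real n + 1) * (n choose k))"
    by (simp del: binomial_Suc_Suc add: algebra_simps)
  also have "\<dots> = (x * (real n - real k) * elem_mean xs (Suc k) + (real k + 1) * elem_mean xs k)
      * (Suc n choose Suc k)"
    unfolding 1[symmetric] 2[symmetric] by (simp del: binomial_Suc_Suc add: algebra_simps)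
  finally show ?thesis
    using nz by (simp add: n_def add.commute[of 1] del: binomial_Suc_Suc)
qed

lemma elem_mean_pos:
  assumes "\<forall>x\<in>set xs. 0 < x" "k \<le> length xs"
  shows "0 < elem_mean xs k"
  using assms
proof (induction xs arbitrary: k)
  case Nil
  then show ?case by (simp add: elem_mean_def)
next
  case (Cons x xs)
  show ?case
  proof (cases k)
    case 0
    then show ?thesis using Cons by (simp add: elem_mean_Cons_0)
  next
    case (Suc j)
    then have j: "j \<le> length xs" using Cons.prems by simp
    have "0 \<le> x * (real (length xs) - real j) * elem_mean xs (Suc j)"
    proof (cases "j = length xs")
      case False
      then show ?thesis
        using j Cons.prems Cons.IH[of "Suc j"] by (intro mult_nonneg_nonneg) auto
    qed simp
    moreover have "0 < (real j + 1) * elem_mean xs j"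
      using j Cons.prems Cons.IH[of j] by (intro mult_pos_pos) auto
    ultimately have "0 < elem_mean (x # xs) (Suc j) * (length xs + 1)"
      unfolding elem_mean_Cons_Suc[OF j] by linarith
    then show ?thesis
      using Suc by (simp add: zero_less_mult_iff)
  qed
qed

text \<open>Induction on the list: the recurrence writes the three means of \<open>x # xs\<close>
  through four means of \<open>xs\<close>, and \<open>newton_step\<close> combines the inequalities
  known for these.\<close>

lemma elem_mean_newton:
  assumes "\<forall>x\<in>set xs. 0 < x" "Suc k < length xs"
  shows "elem_mean xs k * elem_mean xs (Suc (Suc k)) \<le> (elem_mean xs (Suc k))\<^sup>2"
  using assms
proof (induction xs arbitrary: k)
  case (Cons x xs)
  define n where "n = length xs"
  define m where "m = real n - real (Suc k)"
  \<comment> \<open>For \<open>k = 0\<close> truncated subtraction makes \<open>a\<close> equal to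
    \<open>b\<close>; its coefficient \<open>real (Suc k) - 1\<close> is then zero.\<close>
  define a where "a = elem_mean xs (k - 1)"
  define b where "b = elem_mean xs k"
  define c where "c = elem_mean xs (Suc k)"
  define e where "e = elem_mean xs (Suc (Suc k))"
  have k: "Suc k \<le> n" using Cons.prems by (simp add: n_def)
  have pos: "0 < a" "0 < b" "0 < c"
    unfolding a_def b_def c_def using Cons.prems k by (auto intro!: elem_mean_pos simp: n_def)
  have be: "b * e \<le> c\<^sup>2" if "Suc k < n"
    using Cons.IH[of k] Cons.prems that by (auto simp: b_def c_def e_def n_def)
  have ac: "a * c \<le> b\<^sup>2" if "k > 0"
    using Cons.IH[of "k - 1"] Cons.prems that k by (auto simp: a_def b_def c_def n_def)
  have ae: "a * e \<le> b * c" if "k > 0" "Suc k < n"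
  proof -
    have "0 < e"
      unfolding e_def using Cons.prems that by (auto intro!: elem_mean_pos simp: n_def)
    \<comment> \<open>Two neighbouring Newton inequalities are multiplied and the positive factor
      \<open>b * c\<close> is cancelled.\<close>
    have "(a * c) * (b * e) \<le> b\<^sup>2 * c\<^sup>2"
      using be ac that pos \<open>0 < e\<close> by (intro mult_mono) auto
    then have "(a * e) * (b * c) \<le> (b * c) * (b * c)"
      by (simp add: power2_eq_square algebra_simps)
    then show ?thesis
      using pos by simp
  qed
  have n1: "(real n + 1) * elem_mean (x # xs) (Suc j) =
      x * (real n - real j) * elem_mean xs (Suc j) + (real j + 1) * elem_mean xs j"
    if "j \<le> n" for j
    using elem_mean_Cons_Suc[of j xs x] that by (simp add: n_def mult.commute add.commute)
  have "(real n + 1) * elem_mean (x # xs) k = x * (m + 2) * b + (real (Suc k) - 1) * a"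
  proof (cases k)
    case 0
    then show ?thesis
      using elem_mean_Cons_0[of x xs] by (simp add: m_def b_def algebra_simps)
  next
    case (Suc j)
    then show ?thesis
      using n1[of j] k by (simp add: m_def a_def b_def algebra_simps)
  qed
  moreover have "(real n + 1) * elem_mean (x # xs) (Suc k) = x * (m + 1) * c + real (Suc k) * b"
    using n1[of k] k by (simp add: m_def b_def c_def algebra_simps)
  moreover have "(real n + 1) * elem_mean (x # xs) (Suc (Suc k)) =
      x * m * e + (real (Suc k) + 1) * c"
    using n1[of "Suc k"] k by (simp add: m_def c_def e_def algebra_simps)
  moreover have "(x * (m + 2) * b + (real (Suc k) - 1) * a) * (x * m * e + (real (Suc k) + 1) * c)
      \<le> (x * (m + 1) * c + real (Suc k) * b)\<^sup>2"
  proof (rule newton_step)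
    show "0 \<le> m" "1 \<le> real (Suc k)" "0 \<le> x"
      using k Cons.prems by (auto simp: m_def)
    show "m * (b * e) \<le> m * c\<^sup>2"
      using be k by (cases "Suc k = n") (auto simp: m_def intro!: mult_left_mono)
    show "(real (Suc k) - 1) * (a * c) \<le> (real (Suc k) - 1) * b\<^sup>2"
      using ac by (cases "k = 0") (auto intro!: mult_left_mono)
    show "m * (real (Suc k) - 1) * (a * e) \<le> m * (real (Suc k) - 1) * (b * c)"
    proof (cases "k = 0 \<or> Suc k = n")
      case False
      then have "a * e \<le> b * c" "0 \<le> m * (real (Suc k) - 1)"
        using ae k by (auto simp: m_def)
      then show ?thesis
        by (rule mult_left_mono)
    qed (auto simp: m_def)
  qed
  ultimately have "((real n + 1) * elem_mean (x # xs) k) * ((real n + 1) * elem_mean (x # xs) (Suc (Suc k)))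
      \<le> ((real n + 1) * elem_mean (x # xs) (Suc k))\<^sup>2"
    by simp
  then have "(real n + 1)\<^sup>2 * (elem_mean (x # xs) k * elem_mean (x # xs) (Suc (Suc k)))
      \<le> (real n + 1)\<^sup>2 * (elem_mean (x # xs) (Suc k))\<^sup>2"
    by (simp only: power2_eq_square mult_ac)
  then show ?case
    by (rule mult_left_le_imp_le) simp
qed simp

section \<open>Positive log-concave sequences: monotonicity under symmetry, and Maclaurin's
  inequality\<close>

locale log_concave_sequence =
  fixes f :: "nat \<Rightarrow> real" and n :: nat
  assumes pos: "k \<le> n \<Longrightarrow> 0 < f k"
    and log_concave: "Suc k < n \<Longrightarrow> f k * f (Suc (Suc k)) \<le> (f (Suc k))\<^sup>2"
begin

text \<open>By log-concavity the ratios of successive terms decrease; this compares the first with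
  the last ratio, cross-multiplied.\<close>

lemma outer_le_inner:
  "Suc (k + j) \<le> n \<Longrightarrow> f k * f (Suc (k + j)) \<le> f (Suc k) * f (k + j)"
proof (induction j)
  case (Suc j)
  let ?j = "k + j"
  have p: "0 < f k" "0 < f ?j" "0 < f (Suc ?j)"
    using Suc.prems by (auto intro!: pos)
  have "f k * f (Suc (Suc ?j)) * f ?j \<le> f k * (f (Suc ?j))\<^sup>2"
    using log_concave[of ?j] Suc.prems p by (simp add: mult_left_mono mult_ac)
  also have "\<dots> = f k * f (Suc ?j) * f (Suc ?j)"
    by (simp add: power2_eq_square)
  also have "\<dots> \<le> f (Suc k) * f ?j * f (Suc ?j)"
    using Suc p by (intro mult_right_mono) auto
  finally have "f k * f (Suc (Suc ?j)) * f ?j \<le> f (Suc k) * f (Suc ?j) * f ?j"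
    by (simp add: mult_ac)
  then show ?case
    using p by simp
qed (simp add: mult.commute)

lemma symmetric_imp_mono:
  assumes sym: "\<And>k. k \<le> n \<Longrightarrow> f (n - k) = f k"
    and "k \<le> l" "l \<le> n div 2"
  shows "f k \<le> f l"
  using assms(2,3)
proof (induction l rule: dec_induct)
  case (step l)
  have l: "l + l < n" using step.prems by simp
  \<comment> \<open>The offset makes the outer indices \<open>l\<close> and \<open>n - l\<close> and
    the inner ones \<open>Suc l\<close> and \<open>n - Suc l\<close>, so that symmetry turns both
    products into squares.\<close>
  have "f l * f (Suc (l + (n - 2 * l - 1))) \<le> f (Suc l) * f (l + (n - 2 * l - 1))"
    using l by (intro outer_le_inner) auto
  moreover have "Suc (l + (n - 2 * l - 1)) = n - l" "l + (n - 2 * l - 1) = n - Suc l"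
    using l by auto
  ultimately have "f l * f l \<le> f (Suc l) * f (Suc l)"
    using l by (simp add: sym)
  then have "(f l)\<^sup>2 \<le> (f (Suc l))\<^sup>2"
    by (simp add: power2_eq_square)
  then have "f l \<le> f (Suc l)"
    using pos[of "Suc l"] l by (auto intro: power2_le_imp_le)
  then show ?case
    using step by simp
qed simp

text \<open>Maclaurin's inequality without roots. The value \<open>f 0 = 1\<close> starts the
  induction.\<close>

lemma power_Suc_le:
  assumes "f 0 = 1" "Suc k \<le> n"
  shows "f (Suc k) ^ k \<le> f k ^ Suc k"
  using assms(2)
proof (induction k)
  case (Suc k)
  define a b c where "a = f k" and "b = f (Suc k)" and "c = f (Suc (Suc k))"
  have p: "0 < a" "0 < b" "0 < c"
    unfolding a_def b_def c_def using Suc.prems by (auto intro!: pos)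
  have "a * c \<le> b\<^sup>2"
    using log_concave[of k] Suc.prems by (simp add: a_def b_def c_def)
  then have "(a * c) ^ Suc k \<le> (b\<^sup>2) ^ Suc k"
    using p by (intro power_mono) auto
  \<comment> \<open>The induction hypothesis lets \<open>b ^ k\<close> replace
    \<open>a ^ Suc k\<close>; cancelling \<open>b ^ k\<close> afterwards leaves the claim.\<close>
  moreover have "b ^ k * c ^ Suc k \<le> a ^ Suc k * c ^ Suc k"
    using Suc p by (intro mult_right_mono) (auto simp: a_def b_def)
  ultimately have "b ^ k * c ^ Suc k \<le> (b\<^sup>2) ^ Suc k"
    by (simp only: power_mult_distrib)
  also have "(b\<^sup>2) ^ Suc k = b ^ k * b ^ Suc (Suc k)"
    by (simp only: power_mult[symmetric] power_add[symmetric] mult_2 add_Suc add_Suc_right)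
  finally show ?case
    using p by (simp add: b_def c_def)
qed (simp add: assms)

lemma root_Suc_le:
  assumes "f 0 = 1" "1 \<le> k" "Suc k \<le> n"
  shows "root (Suc k) (f (Suc k)) \<le> root k (f k)"
proof -
  have p: "0 < f k" "0 < f (Suc k)"
    using assms by (auto intro!: pos)
  \<comment> \<open>Both roots are raised to the power \<open>k * Suc k\<close>; the form
    \<open>Suc j\<close> is what \<open>power_le_imp_le_base\<close> expects.\<close>
  obtain j where j: "k * Suc k = Suc j"
    using assms(2) by (cases k) auto
  have "root (Suc k) (f (Suc k)) ^ Suc j = f (Suc k) ^ k"
    using p by (simp only: j[symmetric] mult.commute[of k] power_mult real_root_pow_pos2 less_imp_le zero_less_Suc)
  moreover have "root k (f k) ^ Suc j = f k ^ Suc k"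
    using p assms(2) by (simp only: j[symmetric] power_mult) simp
  ultimately have "root (Suc k) (f (Suc k)) ^ Suc j \<le> root k (f k) ^ Suc j"
    using power_Suc_le[OF assms(1,3)] by simp
  moreover have "0 \<le> root k (f k)"
    using p by (intro real_root_ge_zero) simp
  ultimately show ?thesis
    by (rule power_le_imp_le_base)
qed

end

section \<open>Fischer sums through principal minors, and positive definite matrices\<close>

text \<open>\<open>pick S\<close> enumerates \<open>S\<close>, and transporting permutations along
  this bijection preserves signs and matches the Leibniz terms.\<close>

lemma det_submatrix_eq_principal_minor:
  assumes A: "A \<in> carrier_mat d d" and S: "S \<subseteq> {..<d}"
  shows "det (submatrix A S S) = principal_minor (\<lambda>i j. A $$ (i, j)) S"
proof -
  define n where "n = card S"
  have fin: "finite S"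
    using S by (rule finite_subset) simp
  have inj: "inj_on (pick S) {0..<n}"
    by (rule linorder_inj_onI') (metis atLeastLessThan_iff less_irrefl n_def pick_mono)
  have "pick S ` {0..<n} \<subseteq> S"
    by (auto simp: n_def pick_in_set)
  then have im: "pick S ` {0..<n} = S"
    using fin inj by (intro card_subset_eq) (auto simp: card_image n_def)
  then have bij: "bij_betw (pick S) {0..<n} S"
    using inj by (simp add: bij_betw_def)
  have "{i. i < d \<and> i \<in> S} = S"
    using S by auto
  then have sub: "submatrix A S S = mat n n (\<lambda>(i, j). A $$ (pick S i, pick S j))"
    using A by (auto simp: submatrix_def n_def)
  let ?h = "map_permutation {0..<n} (pick S)"
  have "det (submatrix A S S) =
      (\<Sum>p | p permutes {0..<n}. signof p * (\<Prod>i = 0..<n. A $$ (pick S i, pick S (p i))))"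
    unfolding sub by (subst det_def'[of _ n])
      (auto intro!: sum.cong prod.cong dest: permutes_in_image)
  also have "\<dots> = (\<Sum>p | p permutes {0..<n}. signof (?h p) * (\<Prod>i\<in>S. A $$ (i, ?h p i)))"
  proof (rule sum.cong)
    fix p assume "p \<in> {p. p permutes {0..<n}}"
    then have p: "p permutes {0..<n}" by simp
    have "(\<Prod>i\<in>S. A $$ (i, ?h p i)) = (\<Prod>i = 0..<n. A $$ (pick S i, ?h p (pick S i)))"
      using prod.reindex_bij_betw[OF bij, of "\<lambda>i. A $$ (i, ?h p i)"] by simp
    also have "\<dots> = (\<Prod>i = 0..<n. A $$ (pick S i, pick S (p i)))"
      by (simp add: map_permutation_apply[OF inj])
    finally show "signof p * (\<Prod>i = 0..<n. A $$ (pick S i, pick S (p i))) =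
        signof (?h p) * (\<Prod>i\<in>S. A $$ (i, ?h p i))"
      using sign_map_permutation[OF inj p] by simp
  qed simp
  also have "\<dots> = (\<Sum>p | p permutes S. signof p * (\<Prod>i\<in>S. A $$ (i, p i)))"
  proof (rule sum.reindex_bij_betw)
    show "bij_betw ?h {p. p permutes {0..<n}} {p. p permutes S}"
      using bij_betw_permutations[OF bij]
      by (simp add: map_permutation_def[abs_def] restrict_id_def im comp_def)
  qed
  finally show ?thesis
    by (simp add: principal_minor_def)
qed

lemma fischer_sum_eq:
  assumes "A \<in> carrier_mat d d"
  shows "fischer_sum k A = (\<Sum>S | S \<subseteq> {..<d} \<and> card S = k.
    principal_minor (\<lambda>i j. A $$ (i, j)) S * principal_minor (\<lambda>i j. A $$ (i, j)) ({..<d} - S))"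
  using assms by (auto simp: fischer_sum_def atLeast0LessThan
      det_submatrix_eq_principal_minor[OF assms] intro!: sum.cong)

lemma det_eq_principal_minor:
  assumes "A \<in> carrier_mat d d"
  shows "det A = principal_minor (\<lambda>i j. A $$ (i, j)) {..<d}"
  using det_def'[OF assms] by (simp add: principal_minor_def atLeast0LessThan)

lemma principal_minor_empty: "principal_minor M {} = 1"
  by (simp add: principal_minor_def)

lemma principal_minor_scale:
  "principal_minor (\<lambda>i j. c * M i j) K = c ^ card K * principal_minor M K"
  by (simp add: principal_minor_def prod.distrib sum_distrib_left mult_ac)

lemma quad_form_scale: "quad_form d (\<lambda>i j. c * M i j) v = c * quad_form d M v"
  by (simp add: quad_form_def sum_distrib_left mult_ac)

text \<open>Passing from \<open>S\<close> to its complement exchanges the two factors.\<close>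

lemma fischer_sum_symmetric:
  assumes "A \<in> carrier_mat d d" "k \<le> d"
  shows "fischer_sum (d - k) A = fischer_sum k A"
  unfolding fischer_sum_eq[OF assms(1)]
proof (rule sum.reindex_bij_witness[where i = "\<lambda>S. {..<d} - S" and j = "\<lambda>S. {..<d} - S"], goal_cases)
  case (1 S)
  then show ?case by auto
next
  case (2 S)
  then have "finite S" by (auto intro: finite_subset)
  then show ?case using 2 assms(2) by (auto simp: card_Diff_subset)
next
  case (3 S)
  then show ?case by auto
next
  case (4 S)
  then have "finite S" by (auto intro: finite_subset)
  then show ?case using 4 assms(2) by (auto simp: card_Diff_subset)
next
  case (5 S)
  then have "{..<d} - ({..<d} - S) = S" by auto
  then show ?case by simp
qed

lemma hermitian_form_eq_quad_form:
  assumes "A \<in> carrier_mat d d" "v \<in> carrier_vec d"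
  shows "(A *\<^sub>v v) \<bullet>c v = quad_form d (\<lambda>i j. A $$ (i, j)) (($) v)"
  using assms by (auto simp: quad_form_def scalar_prod_def atLeast0LessThan sum_distrib_right
      intro!: sum.cong)

lemma pos_def_mat_quad_form:
  assumes A: "A \<in> carrier_mat d d" and pd: "pos_def_mat A" and v: "\<exists>i<d. v i \<noteq> 0"
  shows "0 < quad_form d (\<lambda>i j. A $$ (i, j)) v"
proof -
  have "vec d v \<noteq> 0\<^sub>v d"
    using v by (metis index_vec index_zero_vec(1))
  then have "0 < (A *\<^sub>v vec d v) \<bullet>c vec d v"
    using pd A unfolding pos_def_mat_def by auto
  also have "\<dots> = quad_form d (\<lambda>i j. A $$ (i, j)) v"
    unfolding hermitian_form_eq_quad_form[OF A vec_carrier] by (simp add: quad_form_def)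
  finally show ?thesis .
qed

text \<open>The form of \<open>A\<close> takes positive real values, so the sign of the imaginary
  part comes from \<open>u\<close>.\<close>

lemma dissipative_scale:
  assumes "A \<in> carrier_mat d d" "pos_def_mat A" "0 < Im u"
  shows "dissipative d (\<lambda>i j. u * A $$ (i, j))"
  unfolding dissipative_def
proof (intro allI impI)
  fix v :: "nat \<Rightarrow> complex" assume "\<exists>i<d. v i \<noteq> 0"
  then have "0 < quad_form d (\<lambda>i j. A $$ (i, j)) v"
    by (rule pos_def_mat_quad_form[OF assms(1,2)])
  then show "0 < Im (quad_form d (\<lambda>i j. u * A $$ (i, j)) v)"
    using assms(3) by (simp add: quad_form_scale less_complex_def)
qed

text \<open>The determinant is the product of the eigenvalues, and an eigenvalue is positive because
  the form at an eigenvector is the eigenvalue times the squared norm.\<close>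

lemma det_pos_def_mat:
  assumes A: "A \<in> carrier_mat d d" and pd: "pos_def_mat A"
  shows "0 < det A"
proof -
  obtain as where as: "char_poly A = (\<Prod>a\<leftarrow>as. [:- a, 1:])" "length as = d"
    using char_poly_factorized[OF A] by blast
  have pos: "0 < a" if "a \<in> set as" for a
  proof -
    have "poly (char_poly A) a = 0"
      unfolding as by (rule linear_poly_root[OF that])
    then have "eigenvalue A a"
      by (simp add: eigenvalue_root_char_poly[OF A])
    then obtain v where v: "v \<in> carrier_vec d" "v \<noteq> 0\<^sub>v d" "A *\<^sub>v v = a \<cdot>\<^sub>v v"
      using A unfolding eigenvalue_def eigenvector_def by auto
    have "0 < (A *\<^sub>v v) \<bullet>c v"
      using pd A v unfolding pos_def_mat_def by auto
    also have "\<dots> = a * (v \<bullet>c v)"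
      using v by (simp add: v(3))
    finally have "0 < a * (v \<bullet>c v)" .
    moreover have "0 < v \<bullet>c v"
      using v by (simp add: conjugate_square_greater_0_vec)
    ultimately show "0 < a"
      by (auto simp: less_complex_def zero_less_mult_iff)
  qed
  have "char_matrix A 0 = A"
    using A by (auto simp: char_matrix_def)
  moreover have "- A = - 1 \<cdot>\<^sub>m A"
    using A by (intro eq_matI) auto
  \<comment> \<open>The characteristic polynomial at 0 is evaluated as the determinant of
    \<open>- A\<close> and through its factorization; the signs cancel.\<close>
  ultimately have "(- 1) ^ d * det A = poly (char_poly A) 0"
    using A by (simp add: char_poly_matrix[OF A])
  also have "\<dots> = (\<Prod>a\<leftarrow>as. - a)"
    unfolding as poly_prod_list by (simp add: comp_def)
  also have "\<dots> = (- 1) ^ d * prod_list as"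
    unfolding as(2)[symmetric] by (induction as) auto
  finally have "det A = prod_list as"
    by simp
  also have "0 < \<dots>"
    using pos by (induction as) (auto simp: less_complex_def)
  finally show ?thesis .
qed

section \<open>The generating polynomial of the Fischer sums and its roots\<close>

lemma sum_fischer_sum_powers:
  assumes "A \<in> carrier_mat d d"
  shows "(\<Sum>k\<le>d. fischer_sum k A * t ^ k) = (\<Sum>S\<in>Pow {..<d}.
    principal_minor (\<lambda>i j. A $$ (i, j)) S * principal_minor (\<lambda>i j. A $$ (i, j)) ({..<d} - S) *
    t ^ card S)"
proof -
  let ?f = "\<lambda>S. principal_minor (\<lambda>i j. A $$ (i, j)) S *
    principal_minor (\<lambda>i j. A $$ (i, j)) ({..<d} - S) * t ^ card S"
  have "(\<Sum>S\<in>Pow {..<d}. ?f S) = (\<Sum>k\<le>d. \<Sum>S | S \<in> Pow {..<d} \<and> card S = k. ?f S)"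
    by (rule sum.group[symmetric]) (auto dest: card_mono[rotated])
  also have "\<dots> = (\<Sum>k\<le>d. fischer_sum k A * t ^ k)"
    unfolding fischer_sum_eq[OF assms] sum_distrib_right by (intro sum.cong) auto
  finally show ?thesis ..
qed

lemma fischer_sum_0:
  assumes "A \<in> carrier_mat d d"
  shows "fischer_sum 0 A = det A"
proof -
  have "{S. S \<subseteq> {..<d} \<and> card S = 0} = {{}}"
    by (auto simp: card_eq_0_iff dest: finite_subset)
  then show ?thesis
    by (simp add: fischer_sum_eq[OF assms] det_eq_principal_minor[OF assms] principal_minor_empty)
qed

text \<open>With \<open>w\<close> the square root of \<open>t\<close> and \<open>u = i cnj w\<close>, both \<open>u\<close> and \<open>u t\<close> lie in the upper
  half plane, and the polynomial times \<open>u\<^sup>d\<close> is the convolution of \<open>u A\<close> and \<open>u t A\<close>.\<close>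

lemma fischer_poly_root:
  assumes A: "A \<in> carrier_mat d d" and pd: "pos_def_mat A"
    and root: "(\<Sum>k\<le>d. fischer_sum k A * t ^ k) = 0"
  obtains x :: real where "0 < x" "t = - of_real x"
proof -
  define w where "w = csqrt t"
  have w: "w\<^sup>2 = t"
    by (simp add: w_def)
  have "t \<noteq> 0"
  proof
    assume "t = 0"
    then have "fischer_sum 0 A = 0"
      using root by (simp add: power_0_left if_distrib cong: if_cong)
    then show False
      using det_pos_def_mat[OF A pd] by (simp add: fischer_sum_0[OF A])
  qed
  show ?thesis
  \<comment> \<open>The principal square root has nonnegative real part. A positive one is
    contradictory; a zero one makes \<open>t\<close> the negative of a square.\<close>
  proof (cases "0 < Re w")
    case True
    let ?M = "\<lambda>i j. A $$ (i, j)"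
    define u where "u = \<i> * cnj w"
    have "u * t = \<i> * (cnj w * w) * w"
      unfolding w[symmetric] u_def by (simp add: power2_eq_square mult_ac)
    also have "cnj w * w = of_real ((cmod w)\<^sup>2)"
      by (simp only: complex_norm_square mult.commute)
    finally have "Im (u * t) = (cmod w)\<^sup>2 * Re w"
      by (simp del: of_real_power)
    moreover have "w \<noteq> 0"
      using True by auto
    ultimately have im: "0 < Im u" "0 < Im (u * t)"
      using True by (auto simp: u_def)
    have "minor_convolution (\<lambda>i j. u * ?M i j) (\<lambda>i j. u * t * ?M i j) {..<d} {..<d} \<noteq> 0"
      using im by (intro minor_convolution_nonzero[of d] dissipative_scale A pd) auto
    moreover have "minor_convolution (\<lambda>i j. u * ?M i j) (\<lambda>i j. u * t * ?M i j) {..<d} {..<d} =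
        u ^ d * (\<Sum>k\<le>d. fischer_sum k A * t ^ k)"
      unfolding minor_convolution_def sum_fischer_sum_powers[OF A] sum_distrib_left
    proof (rule sum.cong)
      \<comment> \<open>In the convolution \<open>S\<close> is what the first minor omits. The minor
        on \<open>S\<close> therefore comes from the second matrix and carries
        \<open>t ^ card S\<close>.\<close>
      fix S assume "S \<in> Pow {..<d}"
      then have S: "S \<subseteq> {..<d}" by simp
      then have "finite S" by (rule finite_subset) simp
      have "card S \<le> d"
        using card_mono[OF _ S] by simp
      then have "u ^ d = u ^ card ({..<d} - S) * u ^ card S"
        using S \<open>finite S\<close> by (simp add: card_Diff_subset flip: power_add)
      moreover have "{..<d} - ({..<d} - S) = S"
        using S by auto
      ultimately show "principal_minor (\<lambda>i j. u * ?M i j) ({..<d} - S) *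
            principal_minor (\<lambda>i j. u * t * ?M i j) ({..<d} - ({..<d} - S)) =
          u ^ d * (principal_minor ?M S * principal_minor ?M ({..<d} - S) * t ^ card S)"
        by (simp only: principal_minor_scale power_mult_distrib mult_ac)
    qed simp
    ultimately show ?thesis
      using root by simp
  next
    case False
    then have re: "Re w = 0"
      using csqrt_principal[of t] by (auto simp: w_def)
    have "t = - of_real ((Im w)\<^sup>2)"
      unfolding w[symmetric] using re by (simp add: complex_eq_iff power2_eq_square)
    moreover from this have "Im w \<noteq> 0"
      using \<open>t \<noteq> 0\<close> by auto
    ultimately show ?thesis
      by (intro that[of "(Im w)\<^sup>2"]) auto
  qed
qed

text \<open>Over the complex numbers the generating polynomial splits into linear factors; all its
  roots are negative reals and \<open>det A\<close> is its leading coefficient.\<close>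

lemma fischer_sum_eq_coeff:
  assumes A: "A \<in> carrier_mat d d" and pd: "pos_def_mat A"
  obtains xs :: "real list" where "length xs = d" "\<forall>x\<in>set xs. 0 < x"
    "\<And>k. k \<le> d \<Longrightarrow> fischer_sum k A = det A * of_real (coeff (\<Prod>x\<leftarrow>xs. [:x, 1:]) k)"
proof -
  define P where "P = (\<Sum>k\<le>d. monom (fischer_sum k A) k)"
  have poly_P: "poly P t = (\<Sum>k\<le>d. fischer_sum k A * t ^ k)" for t
    by (simp add: P_def poly_sum poly_monom)
  have coeff_P: "coeff P k = (if k \<le> d then fischer_sum k A else 0)" for k
    by (simp add: P_def coeff_sum)
  \<comment> \<open>Symmetry identifies the top coefficient with the constant one; being nonzero, it
    fixes the degree at \<open>d\<close>.\<close>
  have lead: "fischer_sum d A = det A"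
    using fischer_sum_symmetric[OF A, of 0] by (simp add: fischer_sum_0[OF A])
  have det: "det A \<noteq> 0"
    using det_pos_def_mat[OF A pd] by auto
  have deg: "degree P = d"
    using det lead coeff_P by (intro antisym degree_le le_degree) auto
  then have "P \<noteq> 0"
    using coeff_P[of d] det lead by auto
  then obtain R where R: "size R = d" "P = smult (det A) (\<Prod>x\<in>#R. [:- x, 1:])"
    using alg_closed_imp_factorization[of P] deg coeff_P[of d] lead by auto
  obtain rs where rs: "mset rs = R"
    using ex_mset by blast
  define xs where "xs = map (\<lambda>r. - Re r) rs"
  have root: "0 < - Re r \<and> r = - of_real (- Re r)" if "r \<in> set rs" for r
  proof -
    have "poly P r = 0"
      using that by (auto simp: R(2) poly_prod_mset prod_mset_zero_iff image_image simp flip: rs)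
    then obtain x where "0 < x" "r = - of_real x"
      using fischer_poly_root[OF A pd, of r] by (auto simp: poly_P)
    then show ?thesis by simp
  qed
  have "(\<Prod>x\<in>#R. [:- x, 1:]) = (\<Prod>r\<leftarrow>rs. [:- r, 1:])"
    by (simp flip: rs prod_mset_prod_list mset_map)
  also have "\<dots> = (\<Prod>x\<leftarrow>xs. [:of_real x, 1:])"
    unfolding xs_def map_map comp_def using root
    by (intro arg_cong[where f = prod_list] map_cong) auto
  finally have P: "P = smult (det A) (\<Prod>x\<leftarrow>xs. [:of_real x, 1:])"
    using R(2) by simp
  have coeff_of_real: "coeff (\<Prod>x\<leftarrow>xs. [:of_real x, 1:]) k =
      complex_of_real (coeff (\<Prod>x\<leftarrow>xs. [:x, 1:]) k)" for k
    by (induction xs arbitrary: k) (auto simp: coeff_pCons split: nat.split)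
  show ?thesis
  proof (rule that)
    show "length xs = d"
      using R(1) rs by (auto simp: xs_def)
    show "\<forall>x\<in>set xs. 0 < x"
      using root by (auto simp: xs_def)
    show "fischer_sum k A = det A * of_real (coeff (\<Prod>x\<leftarrow>xs. [:x, 1:]) k)" if "k \<le> d" for k
      using coeff_P[of k] that by (simp add: P coeff_of_real)
  qed
qed

text \<open>\<open>F\<close> is the sequence of means of the negated roots. Symmetry passes from the
  averages to \<open>F\<close> because \<open>det A\<close> is nonzero, and it yields
  \<open>F d = F 0\<close>.\<close>

lemma fischer_avg_pos_def:
  assumes A: "A \<in> carrier_mat d d" and pd: "pos_def_mat A"
  obtains F where "log_concave_sequence F d" "\<forall>k\<le>d. F (d - k) = F k" "F 0 = 1" "F d = 1"
    "\<forall>k\<le>d. fischer_avg k A = det A * of_real (F k)"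
proof -
  obtain xs where xs: "length xs = d" "\<forall>x\<in>set xs. 0 < x"
    "\<And>k. k \<le> d \<Longrightarrow> fischer_sum k A = det A * of_real (coeff (\<Prod>x\<leftarrow>xs. [:x, 1:]) k)"
    using fischer_sum_eq_coeff[OF A pd] by blast
  have avg: "fischer_avg k A = det A * of_real (elem_mean xs k)" if "k \<le> d" for k
    using A that by (simp add: fischer_avg_def xs elem_mean_def)
  have det: "det A \<noteq> 0"
    using det_pos_def_mat[OF A pd] by auto
  have sym: "elem_mean xs (d - k) = elem_mean xs k" if "k \<le> d" for k
  proof -
    have "fischer_avg (d - k) A = fischer_avg k A"
      using A that fischer_sum_symmetric[OF A that]
      by (simp add: fischer_avg_def flip: binomial_symmetric)
    then show ?thesis
      using avg[of k] avg[of "d - k"] that det by simp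
  qed
  have "fischer_avg 0 A = det A"
    by (simp add: fischer_avg_def fischer_sum_0[OF A])
  then have "elem_mean xs 0 = 1"
    using avg[of 0] det by simp
  moreover have "log_concave_sequence (elem_mean xs) d"
    using xs by unfold_locales (auto intro: elem_mean_pos elem_mean_newton)
  ultimately show ?thesis
    using that[of "elem_mean xs"] avg sym sym[of 0] by auto
qed

section \<open>Perturbation by multiples of the identity and passage to the semidefinite
  case\<close>

lemma hermitian_mat_iff:
  assumes "A \<in> carrier_mat d d"
  shows "hermitian_mat A \<longleftrightarrow> (\<forall>i<d. \<forall>j<d. cnj (A $$ (j, i)) = A $$ (i, j))"
proof -
  have "mat_adjoint A = mat d d (\<lambda>(i, j). cnj (A $$ (j, i)))"
    using assms by (intro eq_matI) (auto simp: mat_adjoint_def mat_of_rows_def)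
  then show ?thesis
    using assms by (auto simp: hermitian_mat_def square_mat.simps mat_eq_iff)
qed

definition shift_mat :: "complex mat \<Rightarrow> real \<Rightarrow> complex mat" where
  "shift_mat A e = A + of_real e \<cdot>\<^sub>m 1\<^sub>m (dim_row A)"

lemma shift_mat_carrier: "A \<in> carrier_mat d d \<Longrightarrow> shift_mat A e \<in> carrier_mat d d"
  by (auto simp: shift_mat_def)

lemma pos_def_shift_mat:
  assumes A: "A \<in> carrier_mat d d" and psd: "pos_semidef_mat A" and "0 < e"
  shows "pos_def_mat (shift_mat A e)"
  unfolding pos_def_mat_def
proof (intro conjI ballI impI)
  show "hermitian_mat (shift_mat A e)"
    using psd A unfolding pos_semidef_mat_def hermitian_mat_iff[OF A]
      hermitian_mat_iff[OF shift_mat_carrier[OF A]] by (auto simp: shift_mat_def)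
  fix v :: "complex vec"
  assume "v \<in> carrier_vec (dim_row (shift_mat A e))" and
    "v \<noteq> 0\<^sub>v (dim_row (shift_mat A e))"
  then have v: "v \<in> carrier_vec d" "v \<noteq> 0\<^sub>v d"
    using shift_mat_carrier[OF A, of e] by auto
  have "shift_mat A e *\<^sub>v v = A *\<^sub>v v + of_real e \<cdot>\<^sub>v v"
    using A v unfolding shift_mat_def by (subst add_mult_distrib_mat_vec[of _ d d]) auto
  then have "(shift_mat A e *\<^sub>v v) \<bullet>c v = (A *\<^sub>v v) \<bullet>c v + of_real e * (v \<bullet>c v)"
    using A v by (simp add: add_scalar_prod_distrib[of _ d])
  moreover have "0 \<le> (A *\<^sub>v v) \<bullet>c v"
    using psd A v by (auto simp: pos_semidef_mat_def)
  moreover have "0 < v \<bullet>c v"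
    using v by (simp add: conjugate_square_greater_0_vec)
  then have "0 < of_real e * (v \<bullet>c v)"
    using \<open>0 < e\<close> by (auto simp: less_complex_def)
  ultimately show "0 < (shift_mat A e *\<^sub>v v) \<bullet>c v"
    by (simp add: add_nonneg_pos)
qed

text \<open>The averages are polynomials in the entries. The limit is from the right, as the shift
  is known to be definite for positive \<open>e\<close>.\<close>

lemma fischer_avg_shift_tendsto:
  assumes A: "A \<in> carrier_mat d d"
  shows "((\<lambda>e. fischer_avg k (shift_mat A e)) \<longlongrightarrow> fischer_avg k A) (at_right 0)"
proof -
  have entry: "((\<lambda>e. shift_mat A e $$ (i, j)) \<longlongrightarrow> A $$ (i, j)) (at_right 0)"
    if "i < d" "j < d" for i j
  proof -
    have "((\<lambda>e. A $$ (i, j) + of_real e * 1\<^sub>m d $$ (i, j)) \<longlongrightarrow> A $$ (i, j) + of_real 0 * 1\<^sub>m d $$ (i, j))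
        (at_right 0)"
      by (intro tendsto_intros)
    then show ?thesis
      using A that by (simp add: shift_mat_def)
  qed
  have minor: "((\<lambda>e. principal_minor (\<lambda>i j. shift_mat A e $$ (i, j)) S) \<longlongrightarrow>
      principal_minor (\<lambda>i j. A $$ (i, j)) S) (at_right 0)" if "S \<subseteq> {..<d}" for S
    unfolding principal_minor_def
  proof (intro tendsto_intros entry)
    fix p i assume "p \<in> {p. p permutes S}" "i \<in> S"
    then show "i < d" "p i < d"
      using that permutes_in_image[of p S i] by auto
  qed
  have "((\<lambda>e. fischer_sum k (shift_mat A e)) \<longlongrightarrow> fischer_sum k A) (at_right 0)"
    unfolding fischer_sum_eq[OF A] fischer_sum_eq[OF shift_mat_carrier[OF A]]
    by (intro tendsto_intros minor) auto
  then have "((\<lambda>e. fischer_sum k (shift_mat A e) / of_nat (d choose k)) \<longlongrightarrow>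
      fischer_sum k A / of_nat (d choose k)) (at_right 0)"
    by (simp add: divide_inverse tendsto_mult_right)
  then show ?thesis
    using A by (simp add: fischer_avg_def carrier_matD(1)[OF shift_mat_carrier[OF A]])
qed

text \<open>Since \<open>det A\<close> is a positive real \<open>D\<close>, the averages are the
  reals \<open>D * F k\<close>, and the inequalities in the complex order reduce to those for
  \<open>F\<close>.\<close>

lemma fischer_avg_pos_def_inequalities:
  assumes A: "A \<in> carrier_mat d d" and pd: "pos_def_mat A"
  shows fischer_avg_nonneg: "k \<le> d \<Longrightarrow> 0 \<le> fischer_avg k A"
    and fischer_avg_mono: "k \<le> l \<Longrightarrow> l \<le> d div 2 \<Longrightarrow> fischer_avg k A \<le> fischer_avg l A"
    and fischer_avg_log_concave: "Suc k < d \<Longrightarrow>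
      fischer_avg k A * fischer_avg (Suc (Suc k)) A \<le> (fischer_avg (Suc k) A)\<^sup>2"
proof -
  obtain F where F: "log_concave_sequence F d" "\<forall>k\<le>d. F (d - k) = F k"
    "F 0 = 1" "F d = 1" "\<forall>k\<le>d. fischer_avg k A = det A * of_real (F k)"
    using fischer_avg_pos_def[OF A pd] .
  interpret log_concave_sequence F d by (rule F(1))
  define D where "D = Re (det A)"
  have D: "0 < D" "det A = of_real D"
    using det_pos_def_mat[OF A pd] by (auto simp: D_def less_complex_def intro: complex_eqI)
  have avg: "fischer_avg k A = of_real (D * F k)" if "k \<le> d" for k
    using F(5) that D by simp
  show "0 \<le> fischer_avg k A" if "k \<le> d"
    using pos[OF that] D by (simp add: avg[OF that] less_eq_complex_def)
  show "fischer_avg k A \<le> fischer_avg l A" if kl: "k \<le> l" "l \<le> d div 2"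
  proof -
    have "D * F k \<le> D * F l"
      using D symmetric_imp_mono[OF _ kl] F(2) by (intro mult_left_mono) auto
    moreover have "k \<le> d" "l \<le> d"
      using kl by auto
    ultimately show ?thesis
      by (simp add: avg less_eq_complex_def del: of_real_mult)
  qed
  show "fischer_avg k A * fischer_avg (Suc (Suc k)) A \<le> (fischer_avg (Suc k) A)\<^sup>2" if k: "Suc k < d"
  proof -
    have "D\<^sup>2 * (F k * F (Suc (Suc k))) \<le> D\<^sup>2 * (F (Suc k))\<^sup>2"
      using log_concave[OF k] by (intro mult_left_mono) auto
    then have "D * F k * (D * F (Suc (Suc k))) \<le> (D * F (Suc k))\<^sup>2"
      by (simp add: power2_eq_square mult_ac)
    then have "complex_of_real (D * F k * (D * F (Suc (Suc k)))) \<le> of_real ((D * F (Suc k))\<^sup>2)"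
      by (simp only: less_eq_complex_def Re_complex_of_real Im_complex_of_real)
    then show ?thesis
      using k avg[of k] avg[of "Suc k"] avg[of "Suc (Suc k)"] by simp
  qed
qed

text \<open>The complex order combines equal imaginary parts with ordered real parts, and both
  conditions are closed.\<close>

lemma tendsto_le_complex:
  fixes f g :: "'a \<Rightarrow> complex"
  assumes "F \<noteq> bot" "(f \<longlongrightarrow> a) F" "(g \<longlongrightarrow> b) F" "\<forall>\<^sub>F x in F. f x \<le> g x"
  shows "a \<le> b"
proof -
  have "\<forall>\<^sub>F x in F. Im (f x) = Im (g x)"
    using assms(4) by eventually_elim (simp add: less_eq_complex_def)
  then have "((\<lambda>x. Im (f x)) \<longlongrightarrow> Im b) F"
    using tendsto_Im[OF assms(3)] by (simp add: tendsto_cong)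
  then have "Im a = Im b"
    using tendsto_Im[OF assms(2)] assms(1) tendsto_unique by blast
  moreover have "\<forall>\<^sub>F x in F. Re (f x) \<le> Re (g x)"
    using assms(4) by eventually_elim (simp add: less_eq_complex_def)
  then have "Re a \<le> Re b"
    using tendsto_le[OF assms(1) tendsto_Re[OF assms(3)] tendsto_Re[OF assms(2)]] by blast
  ultimately show ?thesis
    by (simp add: less_eq_complex_def)
qed

theorem corollary3p1:
  fixes A :: "complex mat" and d :: nat
  assumes "d \<ge> 1"
    and "A \<in> carrier_mat d d"
    and "pos_semidef_mat A"
  shows "(\<forall>k \<le> d. fischer_avg k A \<in> \<real>) \<and>
    (\<forall>k l. k \<le> l \<and> l \<le> d div 2 \<longrightarrow> fischer_avg k A \<le> fischer_avg l A) \<and>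
    (\<forall>k. 1 \<le> k \<and> k \<le> d - 1 \<longrightarrow>
       (fischer_avg k A)\<^sup>2 \<ge> fischer_avg (k - 1) A * fischer_avg (k + 1) A) \<and>
    (pos_def_mat A \<longrightarrow>
       (\<forall>k. 1 \<le> k \<and> k \<le> d - 1 \<longrightarrow>
          root k (Re (fischer_avg k A / det A)) \<ge>
          root (k + 1) (Re (fischer_avg (k + 1) A / det A))) \<and>
       root d (Re (fischer_avg d A / det A)) = 1)"
proof (intro conjI allI impI)
  note A = assms(2)
  have pd: "\<forall>\<^sub>F e in at_right 0. pos_def_mat (shift_mat A e)"
    using eventually_at_right_less[of 0]
    by eventually_elim (rule pos_def_shift_mat[OF A assms(3)])
  have bot: "at_right (0::real) \<noteq> bot"
    by (rule trivial_limit_at_right_real)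
  note lim = fischer_avg_shift_tendsto[OF A]
  note shift = shift_mat_carrier[OF A]
  show "fischer_avg k A \<in> \<real>" if "k \<le> d" for k
  proof -
    \<comment> \<open>Nonnegativity in the complex order survives the limit and includes being
      real.\<close>
    have "0 \<le> fischer_avg k A"
    proof (rule tendsto_le_complex[OF bot tendsto_const lim])
      show "\<forall>\<^sub>F e in at_right 0. 0 \<le> fischer_avg k (shift_mat A e)"
        using pd by eventually_elim (rule fischer_avg_nonneg[OF shift _ that])
    qed
    then show ?thesis
      by (simp add: less_eq_complex_def complex_is_Real_iff)
  qed
  show "fischer_avg k A \<le> fischer_avg l A" if "k \<le> l \<and> l \<le> d div 2" for k l
  proof (rule tendsto_le_complex[OF bot lim lim])
    show "\<forall>\<^sub>F e in at_right 0. fischer_avg k (shift_mat A e) \<le> fischer_avg l (shift_mat A e)"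
      using pd by eventually_elim (use fischer_avg_mono[OF shift] that in blast)
  qed
  show "fischer_avg (k - 1) A * fischer_avg (k + 1) A \<le> (fischer_avg k A)\<^sup>2"
    if "1 \<le> k \<and> k \<le> d - 1" for k
  proof (rule tendsto_le_complex[OF bot tendsto_mult[OF lim lim] tendsto_power[OF lim]])
    define j where "j = k - 1"
    have j: "k = Suc j" "Suc j < d"
      using that by (auto simp: j_def)
    show "\<forall>\<^sub>F e in at_right 0. fischer_avg (k - 1) (shift_mat A e) *
        fischer_avg (k + 1) (shift_mat A e) \<le> (fischer_avg k (shift_mat A e))\<^sup>2"
      using pd by eventually_elim (use fischer_avg_log_concave[OF shift _ j(2)] in \<open>simp add: j(1)\<close>)
  qed
  assume posdef: "pos_def_mat A"
  obtain F where F: "log_concave_sequence F d" "\<forall>k\<le>d. F (d - k) = F k"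
    "F 0 = 1" "F d = 1" "\<forall>k\<le>d. fischer_avg k A = det A * of_real (F k)"
    using fischer_avg_pos_def[OF A posdef] .
  interpret log_concave_sequence F d by (rule F(1))
  have "det A \<noteq> 0"
    using det_pos_def_mat[OF A posdef] by auto
  \<comment> \<open>For (c) \<open>A\<close> itself is definite, so the quotients are exactly the
    values of \<open>F\<close>.\<close>
  then have ratio: "Re (fischer_avg k A / det A) = F k" if "k \<le> d" for k
    using F(5) that by simp
  show "root (k + 1) (Re (fischer_avg (k + 1) A / det A)) \<le> root k (Re (fischer_avg k A / det A))"
    if "1 \<le> k \<and> k \<le> d - 1" for k
  proof -
    have "1 \<le> k" "k \<le> d" "Suc k \<le> d"
      using that by auto
    then show ?thesis
      using root_Suc_le[OF F(3), of k] by (simp add: ratio)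
  qed
  show "root d (Re (fischer_avg d A / det A)) = 1"
    \<comment> \<open>Here \<open>d \<ge> 1\<close> matters, since \<open>root 0\<close> is
      constantly 0.\<close>
    using assms(1) by (simp add: ratio F(4))
qed

end
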